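(* Let $n,d\in\mathbb{N}$ with $n\ge 2$ and let $\kappa\in\mathbb{N}^n$ be such that $\kappa_1=\kappa_2=d$. Define linear operators $S_d,R_d:\mathbb{C}_\kappa[z_1,\ldots,z_n]\to\mathbb{C}_\kappa[z_1,\ldots,z_n]$ by $$S_d\left[\sum_{k=0}^d z_1^kQ_k(z_2,\ldots,z_n)\right]=\frac{1}{d!}\sum_{k=0}^d k!\left(\frac{\partial}{\partial z_2}\right)^{d-k}Q_k(z_2,\ldots,z_n)$$ and $$R_d\left[\sum_{k=0}^d z_1^kQ_k(z_2,\ldots,z_n)\right]=\frac{1}{d!}\sum_{k=0}^d(-1)^k(d-k)!\left(\frac{\partial}{\partial z_2}\right)^{k}Q_k(z_2,\ldots,z_n).$$ Then $S_d$ and $R_d$ preserve stability on $\mathbb{C}_\kappa[z_1,\ldots,z_n]$.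
   Context: $\mathbb{C}_\kappa[z_1,\ldots,z_n]$ is the space of complex polynomials $f$ with $\deg_{z_i}(f)\le\kappa_i$ for all $i$. A polynomial is stable if it is nonzero whenever all its variables have positive imaginary part. A linear operator preserves stability if it maps each stable polynomial in its domain to a stable polynomial or to $0$. *)

theory Defs
  imports Complex_Main "HOL-Library.Poly_Mapping"
begin

section \<open>Multivariate polynomials\<close>

text \<open>
  A monomial is a finitely supported exponent vector \<open>nat \<Rightarrow>\<^sub>0 nat\<close>, and a polynomial is a
  finitely supported coefficient function on monomials, so that the ring structure is the one of
  \<^theory>\<open>HOL-Library.Poly_Mapping\<close>. The variable with index \<open>i\<close> is $z_i$; polynomials in
  $z_1,\ldots,z_n$ use only the indices \<open>1, \<dots>, n\<close>.
\<close>

type_synonym 'a mvpoly = "(nat \<Rightarrow>\<^sub>0 nat) \<Rightarrow>\<^sub>0 'a"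

abbreviation "lookup \<equiv> Poly_Mapping.lookup"
abbreviation "keys \<equiv> Poly_Mapping.keys"
abbreviation "single \<equiv> Poly_Mapping.single"

definition Const :: "'a \<Rightarrow> ('a::zero) mvpoly" where
  "Const c = single 0 c"

definition Var :: "nat \<Rightarrow> ('a::zero_neq_one) mvpoly" where
  "Var i = single (single i 1) 1"

definition eval_mvpoly :: "('a::comm_semiring_1) mvpoly \<Rightarrow> (nat \<Rightarrow> 'a) \<Rightarrow> 'a" where
  "eval_mvpoly p z =
     (\<Sum>m\<in>keys p. lookup p m * (\<Prod>i\<in>keys m. z i ^ lookup m i))"

definition vars :: "('a::zero) mvpoly \<Rightarrow> nat set" where
  "vars p = (\<Union>m\<in>keys p. keys m)"

text \<open>The polynomials in $z_1,\ldots,z_n$ of degree at most $\kappa_i$ in $z_i$; only the values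
  of \<open>\<kappa>\<close> on \<open>{1..n}\<close> matter.\<close>

definition bounded_polys :: "nat \<Rightarrow> (nat \<Rightarrow> nat) \<Rightarrow> complex mvpoly set" where
  "bounded_polys n \<kappa> =
     {p. vars p \<subseteq> {1..n} \<and> (\<forall>m\<in>keys p. \<forall>i\<in>{1..n}. lookup m i \<le> \<kappa> i)}"

text \<open>The coefficient $Q_k$ of $z_i^k$ when \<open>p\<close> is written as $\sum_k z_i^k Q_k$ with $Q_k$ free of
  $z_i$; see \<open>coeff_in_decomposition\<close> and \<open>coeff_in_unique\<close> below.\<close>

definition coeff_in :: "nat \<Rightarrow> nat \<Rightarrow> ('a::comm_monoid_add) mvpoly \<Rightarrow> 'a mvpoly" where
  "coeff_in i k p =
     (\<Sum>m | m \<in> keys p \<and> lookup m i = k.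
        single (Poly_Mapping.update i 0 m) (lookup p m))"

text \<open>The formal derivative with respect to $z_i$. When \<open>lookup m i = 0\<close> the truncated
  subtraction is harmless, since the coefficient is then 0. See \<open>eval_pd\<close> below.\<close>

definition pd :: "nat \<Rightarrow> ('a::comm_semiring_1) mvpoly \<Rightarrow> 'a mvpoly" where
  "pd i p =
     (\<Sum>m\<in>keys p. single (m - single i 1)
        (of_nat (lookup m i) * lookup p m))"

section \<open>Stability and the two operators\<close>

definition stable :: "nat \<Rightarrow> complex mvpoly \<Rightarrow> bool" where
  "stable n p \<longleftrightarrow> (\<forall>z. (\<forall>i\<in>{1..n}. Im (z i) > 0) \<longrightarrow> eval_mvpoly p z \<noteq> 0)"

definition linear_operator_on ::
    "complex mvpoly set \<Rightarrow> (complex mvpoly \<Rightarrow> complex mvpoly) \<Rightarrow> bool" where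
  "linear_operator_on V T \<longleftrightarrow>
     (\<forall>p\<in>V. T p \<in> V) \<and>
     (\<forall>p\<in>V. \<forall>q\<in>V. T (p + q) = T p + T q) \<and>
     (\<forall>c. \<forall>p\<in>V. T (Const c * p) = Const c * T p)"

definition preserves_stability ::
    "nat \<Rightarrow> complex mvpoly set \<Rightarrow> (complex mvpoly \<Rightarrow> complex mvpoly) \<Rightarrow> bool" where
  "preserves_stability n V T \<longleftrightarrow>
     (\<forall>p\<in>V. stable n p \<longrightarrow> stable n (T p) \<or> T p = 0)"

text \<open>Both operators are linear maps of \<open>bounded_polys n \<kappa>\<close> into itself
  (\<open>linear_operator_on_S_op\<close>, \<open>linear_operator_on_R_op\<close>); applied to $\sum_k z_1^k Q_k$ they are
  given by \<open>S_op_sum\<close> and \<open>R_op_sum\<close>.\<close>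

definition S_op :: "nat \<Rightarrow> complex mvpoly \<Rightarrow> complex mvpoly" where
  "S_op d p = Const (1 / fact d) *
     (\<Sum>k=0..d. Const (fact k) * (pd 2 ^^ (d - k)) (coeff_in 1 k p))"

definition R_op :: "nat \<Rightarrow> complex mvpoly \<Rightarrow> complex mvpoly" where
  "R_op d p = Const (1 / fact d) *
     (\<Sum>k=0..d. Const ((-1) ^ k * fact (d - k)) * (pd 2 ^^ k) (coeff_in 1 k p))"

section \<open>Basic facts\<close>

lemma poly_mapping_eq_sum:
  fixes p :: "('b \<Rightarrow>\<^sub>0 'a::comm_monoid_add)"
  shows "p = (\<Sum>m\<in>keys p. single m (lookup p m))"
proof (rule poly_mapping_eqI)
  fix x
  have "lookup (\<Sum>m\<in>keys p. single m (lookup p m)) x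
      = (\<Sum>m\<in>keys p. if m = x then lookup p x else 0)"
    unfolding lookup_sum by (rule sum.cong) (auto simp: lookup_single when_def)
  also have "\<dots> = lookup p x"
    by (simp add: sum.delta in_keys_iff)
  finally show "lookup p x = lookup (\<Sum>m\<in>keys p. single m (lookup p m)) x" ..
qed

lemma lookup_Const_mult [simp]:
  fixes p :: "('a::comm_semiring_1) mvpoly"
  shows "lookup (Const c * p) m = c * lookup p m"
  unfolding Const_def mult_map_scale_conv_mult[symmetric]
  by (simp add: map.rep_eq when_def)

lemma Var_power: "(Var i :: ('a::comm_semiring_1) mvpoly) ^ k = single (single i k) 1"
  by (induction k) (simp_all add: Var_def mult_single single_add[symmetric])

lemma lookup_coeff_in:
  "lookup (coeff_in i k p) m = (if lookup m i = 0 then lookup p (m + single i k) else 0)"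
proof -
  have eq: "lookup m' i = k \<and> Poly_Mapping.update i 0 m' = m
      \<longleftrightarrow> lookup m i = 0 \<and> m' = m + single i k" for m'
    by (auto simp: poly_mapping_eq_iff fun_eq_iff lookup_update lookup_add lookup_single when_def
        split: if_splits)
  have "lookup (coeff_in i k p) m
      = (\<Sum>m' | m' \<in> keys p \<and> lookup m' i = k. lookup p m' when Poly_Mapping.update i 0 m' = m)"
    by (simp add: coeff_in_def lookup_sum lookup_single)
  also have "\<dots> = (\<Sum>m'\<in>keys p. if lookup m' i = k \<and> Poly_Mapping.update i 0 m' = m
                     then lookup p m' else 0)"
    by (rule sum.mono_neutral_cong_left) (auto simp: when_def)
  also have "\<dots> = (\<Sum>m'\<in>keys p. if m' = m + single i k
                     then (if lookup m i = 0 then lookup p m' else 0) else 0)"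
    unfolding eq by (rule sum.cong) auto
  also have "\<dots> = (if lookup m i = 0 then lookup p (m + single i k) else 0)"
    by (simp add: sum.delta in_keys_iff)
  finally show ?thesis .
qed

lemma lookup_pd:
  "lookup (pd i p) m = of_nat (Suc (lookup m i)) * lookup p (m + single i 1)"
proof -
  let ?e = "single i (1::nat)"
  have eq: "lookup m' i \<noteq> 0 \<and> m' - ?e = m \<longleftrightarrow> m' = m + ?e" for m'
  proof
    assume "m' = m + ?e"
    then show "lookup m' i \<noteq> 0 \<and> m' - ?e = m"
      by (simp add: lookup_add)
  next
    assume *: "lookup m' i \<noteq> 0 \<and> m' - ?e = m"
    then have "lookup m j = lookup m' j - lookup ?e j" for j
      by (metis lookup_minus)
    then show "m' = m + ?e" using *
      by (intro poly_mapping_eqI) (auto simp: lookup_add lookup_single when_def)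
  qed
  have "lookup (pd i p) m
      = (\<Sum>m'\<in>keys p. of_nat (lookup m' i) * lookup p m' when m' - ?e = m)"
    by (simp add: pd_def lookup_sum lookup_single)
  also have "\<dots> = (\<Sum>m'\<in>keys p. if lookup m' i \<noteq> 0 \<and> m' - ?e = m
                     then of_nat (lookup m' i) * lookup p m' else 0)"
    by (rule sum.cong) (auto simp: when_def)
  also have "\<dots> = of_nat (lookup (m + ?e) i) * lookup p (m + ?e)"
    unfolding eq by (simp add: sum.delta in_keys_iff)
  finally show ?thesis by (simp add: lookup_add)
qed

lemma coeff_in_add: "coeff_in i k (p + q) = coeff_in i k p + coeff_in i k q"
  by (rule poly_mapping_eqI) (simp add: lookup_coeff_in lookup_add)

lemma coeff_in_0 [simp]: "coeff_in i k 0 = 0"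
  by (rule poly_mapping_eqI) (simp add: lookup_coeff_in)

lemma coeff_in_sum: "coeff_in i k (sum f A) = (\<Sum>x\<in>A. coeff_in i k (f x))"
  by (induction A rule: infinite_finite_induct) (simp_all add: coeff_in_add)

lemma coeff_in_Const_mult:
  fixes p :: "('a::comm_semiring_1) mvpoly"
  shows "coeff_in i k (Const c * p) = Const c * coeff_in i k p"
  by (rule poly_mapping_eqI) (simp add: lookup_coeff_in)

lemma pd_add: "pd i (p + q) = pd i p + pd i q"
  by (rule poly_mapping_eqI) (simp add: lookup_pd lookup_add algebra_simps)

lemma pd_Const_mult:
  fixes p :: "('a::comm_semiring_1) mvpoly"
  shows "pd i (Const c * p) = Const c * pd i p"
  by (rule poly_mapping_eqI) (simp add: lookup_pd mult.left_commute)

lemma pd_funpow_add: "(pd i ^^ k) (p + q) = (pd i ^^ k) p + (pd i ^^ k) q"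
  by (induction k) (simp_all add: pd_add)

lemma pd_funpow_Const_mult:
  fixes p :: "('a::comm_semiring_1) mvpoly"
  shows "(pd i ^^ k) (Const c * p) = Const c * (pd i ^^ k) p"
  by (induction k) (simp_all add: pd_Const_mult)

lemma coeff_in_decomposition:
  fixes p :: "('a::comm_semiring_1) mvpoly"
  assumes "\<And>m. m \<in> keys p \<Longrightarrow> lookup m i \<le> d"
  shows "p = (\<Sum>k=0..d. Var i ^ k * coeff_in i k p)"
proof -
  have 1: "single i (lookup m i) + Poly_Mapping.update i 0 m = m"
    for m :: "nat \<Rightarrow>\<^sub>0 nat"
    by (rule poly_mapping_eqI) (simp add: lookup_add lookup_update lookup_single when_def)
  have "(\<Sum>k=0..d. Var i ^ k * coeff_in i k p)
      = (\<Sum>k=0..d. \<Sum>m | m \<in> keys p \<and> lookup m i = k. single m (lookup p m))"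
    by (auto simp: coeff_in_def Var_power sum_distrib_left mult_single 1 intro!: sum.cong)
  also have "\<dots> = (\<Sum>m\<in>keys p. single m (lookup p m))"
    by (rule sum.group) (use assms in auto)
  finally show ?thesis by (simp flip: poly_mapping_eq_sum)
qed

lemma vars_coeff_in: "i \<notin> vars (coeff_in i k p)"
  by (auto simp: vars_def in_keys_iff lookup_coeff_in split: if_splits)

lemma coeff_in_Var_power_mult:
  fixes q :: "('a::comm_semiring_1) mvpoly"
  assumes "i \<notin> vars q"
  shows "coeff_in i k (Var i ^ j * q) = (if j = k then q else 0)"
proof -
  have 1: "coeff_in i k (single (single i j + m) (lookup q m))
      = (if j = k then single m (lookup q m) else 0)" if "m \<in> keys q" for m
  proof -
    have "lookup m i = 0"
      using assms that by (auto simp: vars_def in_keys_iff)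
    have eq: "single i j + m = m' + single i k \<longleftrightarrow> j = k \<and> m = m'"
      if "lookup m' i = 0" for m'
    proof
      assume *: "single i j + m = m' + single i k"
      have "lookup (single i j + m) i = lookup (m' + single i k) i"
        by (simp only: *)
      then have "j = k"
        using \<open>lookup m i = 0\<close> that by (simp add: lookup_add)
      with * show "j = k \<and> m = m'"
        by (simp add: add.commute[of m'])
    qed (simp add: add.commute)
    show ?thesis
      using \<open>lookup m i = 0\<close>
      by (intro poly_mapping_eqI) (auto simp: lookup_coeff_in lookup_single when_def eq)
  qed
  have "Var i ^ j * q
      = (\<Sum>m\<in>keys q. single (single i j + m) (lookup q m))"
    using arg_cong[OF poly_mapping_eq_sum[of q], of "\<lambda>x. Var i ^ j * x"]
    by (simp only: Var_power sum_distrib_left mult_single mult_1)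
  then have "coeff_in i k (Var i ^ j * q)
      = (\<Sum>m\<in>keys q. if j = k then single m (lookup q m) else 0)"
    by (simp add: coeff_in_sum 1)
  then show ?thesis by (simp flip: poly_mapping_eq_sum)
qed

lemma coeff_in_unique:
  fixes Q :: "nat \<Rightarrow> ('a::comm_semiring_1) mvpoly"
  assumes "\<And>k. k \<le> d \<Longrightarrow> i \<notin> vars (Q k)" and "k \<le> d"
  shows "coeff_in i k (\<Sum>j=0..d. Var i ^ j * Q j) = Q k"
proof -
  have "coeff_in i k (\<Sum>j=0..d. Var i ^ j * Q j) = (\<Sum>j=0..d. if j = k then Q j else 0)"
    using assms(1) by (simp add: coeff_in_sum coeff_in_Var_power_mult)
  with assms(2) show ?thesis by simp
qed

lemma S_op_sum:
  assumes "\<And>k. k \<le> d \<Longrightarrow> 1 \<notin> vars (Q k)"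
  shows "S_op d (\<Sum>k=0..d. Var 1 ^ k * Q k) =
    Const (1 / fact d) * (\<Sum>k=0..d. Const (fact k) * (pd 2 ^^ (d - k)) (Q k))"
  unfolding S_op_def
  by (intro arg_cong2[where f = "(*)"] refl sum.cong) (subst coeff_in_unique, use assms in auto)

lemma R_op_sum:
  assumes "\<And>k. k \<le> d \<Longrightarrow> 1 \<notin> vars (Q k)"
  shows "R_op d (\<Sum>k=0..d. Var 1 ^ k * Q k) =
    Const (1 / fact d) * (\<Sum>k=0..d. Const ((-1) ^ k * fact (d - k)) * (pd 2 ^^ k) (Q k))"
  unfolding R_op_def
  by (intro arg_cong2[where f = "(*)"] refl sum.cong) (subst coeff_in_unique, use assms in auto)

lemma eval_mvpoly_add: "eval_mvpoly (p + q) z = eval_mvpoly p z + eval_mvpoly q z"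
  unfolding eval_mvpoly_def by (rule setsum_keys_plus_distrib) (simp_all add: algebra_simps)

lemma eval_mvpoly_sum: "eval_mvpoly (sum f A) z = (\<Sum>x\<in>A. eval_mvpoly (f x) z)"
  by (induction A rule: infinite_finite_induct)
    (simp_all add: eval_mvpoly_add, simp_all add: eval_mvpoly_def)

lemma eval_mvpoly_single:
  "eval_mvpoly (single m c) z = c * (\<Prod>i\<in>keys m. z i ^ lookup m i)"
  by (simp add: eval_mvpoly_def)

lemma monomial_split:
  fixes z :: "nat \<Rightarrow> 'a::comm_semiring_1"
  shows "(\<Prod>j\<in>keys m. z j ^ lookup m j) = z i ^ lookup m i * (\<Prod>j\<in>keys m - {i}. z j ^ lookup m j)"
  by (cases "i \<in> keys m") (simp_all add: prod.remove in_keys_iff)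

lemma eval_pd:
  fixes p :: "complex mvpoly"
  shows "((\<lambda>t. eval_mvpoly p (z(i := t))) has_field_derivative eval_mvpoly (pd i p) z) (at (z i))"
proof -
  have 1: "((\<lambda>t. \<Prod>j\<in>keys m. (z(i := t)) j ^ lookup m j) has_field_derivative
      of_nat (lookup m i) *
        (\<Prod>j\<in>keys (m - single i 1). z j ^ lookup (m - single i 1) j))
      (at (z i))" for m
  proof -
    let ?c = "\<Prod>j\<in>keys m - {i}. z j ^ lookup m j"
    have a: "(\<Prod>j\<in>keys m. (z(i := t)) j ^ lookup m j) = t ^ lookup m i * ?c" for t
      by (subst monomial_split[of _ _ i]) (auto intro!: arg_cong2[where f = "(*)"] prod.cong)
    have k: "keys (m - single i 1) - {i} = keys m - {i}"
      by (auto simp: in_keys_iff lookup_minus lookup_single when_def)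
    have b: "(\<Prod>j\<in>keys (m - single i 1). z j ^ lookup (m - single i 1) j)
        = z i ^ (lookup m i - 1) * ?c"
      by (subst monomial_split[of _ _ i], subst k)
        (auto simp: lookup_minus lookup_single when_def intro!: arg_cong2[where f = "(*)"] prod.cong)
    show ?thesis
      unfolding a b by (auto intro!: derivative_eq_intros)
  qed
  have "((\<lambda>t. \<Sum>m\<in>keys p. lookup p m * (\<Prod>j\<in>keys m. (z(i := t)) j ^ lookup m j))
      has_field_derivative
      (\<Sum>m\<in>keys p. lookup p m * (of_nat (lookup m i) *
        (\<Prod>j\<in>keys (m - single i 1). z j ^ lookup (m - single i 1) j)))) (at (z i))"
    by (intro DERIV_sum DERIV_cmult 1)
  then show ?thesis
    unfolding pd_def eval_mvpoly_sum eval_mvpoly_single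
    unfolding eval_mvpoly_def
    by (simp only: mult_ac)
qed

lemma bounded_polys_iff:
  "p \<in> bounded_polys n \<kappa> \<longleftrightarrow>
     (\<forall>m. lookup p m \<noteq> 0 \<longrightarrow> (\<forall>i. lookup m i \<le> (if i \<in> {1..n} then \<kappa> i else 0)))"
proof
  assume p: "p \<in> bounded_polys n \<kappa>"
  show "\<forall>m. lookup p m \<noteq> 0 \<longrightarrow> (\<forall>i. lookup m i \<le> (if i \<in> {1..n} then \<kappa> i else 0))"
  proof (intro allI impI)
    fix m i
    assume "lookup p m \<noteq> 0"
    then have m: "m \<in> keys p"
      by (simp add: in_keys_iff)
    show "lookup m i \<le> (if i \<in> {1..n} then \<kappa> i else 0)"
    proof (cases "i \<in> {1..n}")
      case True
      then show ?thesis using p m by (simp add: bounded_polys_def)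
    next
      case False
      then have "i \<notin> keys m" using p m by (auto simp: bounded_polys_def vars_def)
      with False show ?thesis by (simp add: in_keys_iff)
    qed
  qed
next
  assume *: "\<forall>m. lookup p m \<noteq> 0 \<longrightarrow> (\<forall>i. lookup m i \<le> (if i \<in> {1..n} then \<kappa> i else 0))"
  have le: "lookup m i \<le> (if i \<in> {1..n} then \<kappa> i else 0)" if "m \<in> keys p" for m i
    using * that unfolding in_keys_iff by blast
  have "i \<in> {1..n}" if "m \<in> keys p" "i \<in> keys m" for m i
  proof (rule ccontr)
    assume "i \<notin> {1..n}"
    with le[OF that(1), of i] that(2) show False
      by (simp only: in_keys_iff if_False le_0_eq)
  qed
  moreover have "lookup m i \<le> \<kappa> i" if "m \<in> keys p" "i \<in> {1..n}" for m i
    using le[OF that(1), of i] that(2) by (simp only: if_True)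
  ultimately show "p \<in> bounded_polys n \<kappa>"
    unfolding bounded_polys_def vars_def by blast
qed

lemma bounded_polys_0: "0 \<in> bounded_polys n \<kappa>"
  by (simp add: bounded_polys_iff)

lemma bounded_polys_add:
  assumes "p \<in> bounded_polys n \<kappa>" and "q \<in> bounded_polys n \<kappa>"
  shows "p + q \<in> bounded_polys n \<kappa>"
  unfolding bounded_polys_iff
proof (intro allI impI)
  fix m i
  assume "lookup (p + q) m \<noteq> 0"
  then have "lookup p m \<noteq> 0 \<or> lookup q m \<noteq> 0"
    by (auto simp: lookup_add)
  with assms show "lookup m i \<le> (if i \<in> {1..n} then \<kappa> i else 0)"
    unfolding bounded_polys_iff by blast
qed

lemma bounded_polys_sum:
  "(\<And>x. x \<in> A \<Longrightarrow> f x \<in> bounded_polys n \<kappa>) \<Longrightarrow> sum f A \<in> bounded_polys n \<kappa>"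
  by (induction A rule: infinite_finite_induct) (simp_all add: bounded_polys_0 bounded_polys_add)

lemma bounded_polys_Const_mult: "p \<in> bounded_polys n \<kappa> \<Longrightarrow> Const c * p \<in> bounded_polys n \<kappa>"
  by (simp add: bounded_polys_iff)

lemma bounded_polys_coeff_in:
  assumes "p \<in> bounded_polys n \<kappa>"
  shows "coeff_in i k p \<in> bounded_polys n \<kappa>"
  unfolding bounded_polys_iff
proof (intro allI impI)
  fix m j
  assume "lookup (coeff_in i k p) m \<noteq> 0"
  then have "lookup p (m + single i k) \<noteq> 0"
    by (auto simp: lookup_coeff_in split: if_splits)
  with assms have "lookup (m + single i k) j \<le> (if j \<in> {1..n} then \<kappa> j else 0)"
    unfolding bounded_polys_iff by blast
  then show "lookup m j \<le> (if j \<in> {1..n} then \<kappa> j else 0)"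
    unfolding lookup_add by linarith
qed

lemma bounded_polys_pd:
  assumes "p \<in> bounded_polys n \<kappa>"
  shows "pd i p \<in> bounded_polys n \<kappa>"
  unfolding bounded_polys_iff
proof (intro allI impI)
  fix m j
  assume "lookup (pd i p) m \<noteq> 0"
  then have "lookup p (m + single i 1) \<noteq> 0"
    by (auto simp: lookup_pd)
  with assms have "lookup (m + single i 1) j \<le> (if j \<in> {1..n} then \<kappa> j else 0)"
    unfolding bounded_polys_iff by blast
  then show "lookup m j \<le> (if j \<in> {1..n} then \<kappa> j else 0)"
    unfolding lookup_add by linarith
qed

lemma bounded_polys_pd_funpow:
  "p \<in> bounded_polys n \<kappa> \<Longrightarrow> (pd i ^^ k) p \<in> bounded_polys n \<kappa>"
  by (induction k) (simp_all add: bounded_polys_pd)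

lemma linear_operator_on_S_op: "linear_operator_on (bounded_polys n \<kappa>) (S_op d)"
  unfolding linear_operator_on_def
proof (intro conjI ballI allI)
  fix p q c
  show "S_op d p \<in> bounded_polys n \<kappa>" if "p \<in> bounded_polys n \<kappa>"
    unfolding S_op_def
    by (intro bounded_polys_Const_mult bounded_polys_sum bounded_polys_pd_funpow
        bounded_polys_coeff_in that)
  show "S_op d (p + q) = S_op d p + S_op d q"
    unfolding S_op_def coeff_in_add pd_funpow_add distrib_left sum.distrib ..
  show "S_op d (Const c * p) = Const c * S_op d p"
    unfolding S_op_def coeff_in_Const_mult pd_funpow_Const_mult sum_distrib_left
    by (intro sum.cong refl) (simp only: mult_ac)
qed

lemma linear_operator_on_R_op: "linear_operator_on (bounded_polys n \<kappa>) (R_op d)"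
  unfolding linear_operator_on_def
proof (intro conjI ballI allI)
  fix p q c
  show "R_op d p \<in> bounded_polys n \<kappa>" if "p \<in> bounded_polys n \<kappa>"
    unfolding R_op_def
    by (intro bounded_polys_Const_mult bounded_polys_sum bounded_polys_pd_funpow
        bounded_polys_coeff_in that)
  show "R_op d (p + q) = R_op d p + R_op d q"
    unfolding R_op_def coeff_in_add pd_funpow_add distrib_left sum.distrib ..
  show "R_op d (Const c * p) = Const c * R_op d p"
    unfolding R_op_def coeff_in_Const_mult pd_funpow_Const_mult sum_distrib_left
    by (intro sum.cong refl) (simp only: mult_ac)
qed

end

theory Submission
  imports Defs "HOL-Complex_Analysis.Complex_Analysis"
    "HOL-Computational_Algebra.Fundamental_Theorem_Algebra"
begin

text \<open>
  The operator $R_d$ is treated first. Freeze a point $z$ with positive imaginary parts and expand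
  $f(x,s) = p(x, z_2+s, z_3, \ldots) = \sum_{k,j\le d} a_{kj}x^ks^j$. Taylor's formula turns the
  value of $R_d[p]$ at $z$ into the number $\sum_k (-1)^k a_{kk}/{d\choose k}$, a linear functional
  of $f$, and stability of $p$ says that $f$ has no zero with $\Im x>0$ and $\Im s>-\Im z_2$.

  The functional is a bivariate form of the apolar pairing in Grace's theorem. If
  both zero-free half-planes reach below the real line, it is nonzero by the induction that proves
  that theorem. Write $a_{kj}={d\choose k}{d\choose j}\alpha_{kj}$.
  Laguerre's theorem on polar derivatives (\<open>laguerre_polar\<close>), applied in $x$ and in $s$, splits
  off one new variable from each: it produces a polynomial $a+bx_1+cs_1+ex_1s_1$, without zeros in
  the same half-planes, whose coefficients are bivariate polynomials of degree $d-1$ in $x$ and in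
  $s$. For such a biaffine polynomial $a\neq e$ (\<open>biaffine_functional_nonzero\<close>). Since $a-e$ has
  the coefficients $\alpha_{kj}-\alpha_{k+1,j+1}$, Pascal's rule shows that the functional of degree
  $d-1$ at $a-e$ is the functional of degree $d$ at $f$
  (\<open>diagonal_functional_nonzero\<close>).

  The biaffine case needs both half-planes to contain the real line; otherwise the functional can
  vanish, as it does on $f=x$ for $d\ge 1$. The half-plane of $s$ is large enough because
  $\Im z_2>0$; for $x$, the polynomial $p$ is replaced by its translate in $z_1$ by $i\epsilon$,
  and Hurwitz's theorem on a complex line through $z$ and a point where $R_d[p]$ does not vanish
  takes care of the limit $\epsilon\to0$ (\<open>stable_R_op\<close>).

  Finally $S_d[p]=R_d[q]$ for $q=(-z_1)^d\,p(-1/z_1,z_2,\ldots)$, and $q$ is stable because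
  $z_1\mapsto -1/z_1$ maps the upper half-plane to itself.
\<close>

section \<open>Polar derivatives\<close>

lemma sum_binomial_Suc:
  fixes g :: "nat \<Rightarrow> 'a::comm_semiring_1"
  shows "(\<Sum>k\<le>Suc m. of_nat (Suc m choose k) * g k) =
         (\<Sum>k\<le>m. of_nat (m choose k) * (g k + g (Suc k)))"
proof -
  have "(\<Sum>k\<le>Suc m. of_nat (Suc m choose k) * g k) =
      g 0 + (\<Sum>k\<le>m. of_nat (m choose k) * g (Suc k) + of_nat (m choose Suc k) * g (Suc k))"
    by (subst sum.atMost_Suc_shift) (simp add: algebra_simps)
  also have "\<dots> = (\<Sum>k\<le>m. of_nat (m choose k) * g (Suc k)) +
      (\<Sum>k\<le>Suc m. of_nat (m choose k) * g k)"
    unfolding sum.atMost_Suc_shift[of "\<lambda>k. of_nat (m choose k) * g k"]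
    by (simp add: sum.distrib algebra_simps)
  also have "(\<Sum>k\<le>Suc m. of_nat (m choose k) * g k) = (\<Sum>k\<le>m. of_nat (m choose k) * g k)"
    by (simp add: binomial_eq_0)
  finally show ?thesis
    by (simp add: sum.distrib distrib_left add.commute del: sum.atMost_Suc)
qed

text \<open>
  The logarithmic derivative is the sum of $1/(x-r)$ over the roots $r$. All of them lie in
  $\Im r\le-\epsilon$, so each summand lies in the disc $h|w|^2+\Im w\le0$ with
  $h=\Im x+\epsilon$, the image of that half-plane under $r\mapsto1/(x-r)$. The disc is convex
  and contains $0$, so a sum of at most $d$ of its points lies in its $d$-fold dilation.
\<close>

lemma log_deriv_in_disc:
  fixes P :: "complex poly"
  assumes "degree P \<le> d" and "\<And>u. Im u > - \<epsilon> \<Longrightarrow> poly P u \<noteq> 0" and "Im x > - \<epsilon>"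
  shows "(Im x + \<epsilon>) * (cmod (poly (pderiv P) x / poly P x))\<^sup>2
           + real d * Im (poly (pderiv P) x / poly P x) \<le> 0"
  using assms(1,2)
proof (induction d arbitrary: P)
  case 0
  then show ?case by (auto elim!: degree_eq_zeroE)
next
  case (Suc m)
  define h where "h = Im x + \<epsilon>"
  have h: "h > 0" using assms(3) by (simp add: h_def)
  show ?case
  proof (cases "degree P = 0")
    case True
    then show ?thesis by (auto elim!: degree_eq_zeroE)
  next
    case False
    then have "\<not> constant (poly P)"
      by (simp add: constant_degree)
    then obtain r where "poly P r = 0"
      using fundamental_theorem_of_algebra by blast
    then obtain P1 where P: "P = [:- r, 1:] * P1"
      by (metis poly_eq_0_iff_dvd dvdE)
    have r: "Im r \<le> - \<epsilon>"
      using Suc.prems(2)[of r] \<open>poly P r = 0\<close> by force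
    have "P1 \<noteq> 0" using False P by auto
    have deg: "degree P1 \<le> m"
      using Suc.prems(1) \<open>P1 \<noteq> 0\<close> by (simp add: P degree_mult_eq del: mult_pCons_left)
    have nz: "poly P1 u \<noteq> 0" if "Im u > - \<epsilon>" for u
      using Suc.prems(2)[OF that] by (auto simp: P)
    define w where "w = 1 / (x - r)"
    define v where "v = poly (pderiv P1) x / poly P1 x"
    have xr: "x - r \<noteq> 0" using r assms(3) by auto
    have sum: "poly (pderiv P) x / poly P x = w + v"
    proof -
      have "pderiv P = P1 + [:- r, 1:] * pderiv P1"
        unfolding P by (subst pderiv_mult) (simp add: pderiv_pCons)
      then have "poly (pderiv P) x = poly P1 x + (x - r) * poly (pderiv P1) x"
        by (simp only: poly_add poly_mult) simp
      moreover have "poly P x = (x - r) * poly P1 x"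
        by (simp add: P algebra_simps)
      ultimately show ?thesis
        using xr nz[OF assms(3)] unfolding w_def v_def by (simp add: add_divide_distrib)
    qed
    have IH: "h * (cmod v)\<^sup>2 + real m * Im v \<le> 0"
      using Suc.IH[OF deg nz] by (simp add: v_def h_def)
    have w: "h * (cmod w)\<^sup>2 + Im w \<le> 0"
    proof -
      have "Im w = - Im (x - r) * (cmod w)\<^sup>2"
        unfolding w_def by (simp add: Im_divide norm_divide cmod_power2 power_divide)
      moreover have "h \<le> Im (x - r)" using r by (simp add: h_def)
      ultimately show ?thesis
        using mult_right_mono[of h "Im (x - r)" "(cmod w)\<^sup>2"] by (simp add: algebra_simps)
    qed
    have "h * (cmod (w + v))\<^sup>2 + (real m + 1) * Im (w + v) \<le> 0"
    proof (cases "m = 0")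
      case True
      then have "degree P1 = 0" using deg by simp
      then have "v = 0" unfolding v_def by (auto elim!: degree_eq_zeroE)
      then show ?thesis using w True by simp
    next
      case False
      then have m: "real m > 0" by simp
      \<comment> \<open>Convexity of the squared modulus, with weights $1/(m+1)$ and $m/(m+1)$ at $w$ and $v/m$,
        cleared of denominators.\<close>
      have cv: "real m * (cmod (w + v))\<^sup>2 \<le> (real m + 1) * (real m * (cmod w)\<^sup>2 + (cmod v)\<^sup>2)"
      proof -
        have "0 \<le> (real m * Re w - Re v)\<^sup>2 + (real m * Im w - Im v)\<^sup>2" by simp
        then show ?thesis
          unfolding cmod_power2 by (simp add: power2_eq_square algebra_simps)
      qed
      have "real m * (h * (cmod (w + v))\<^sup>2 + (real m + 1) * Im (w + v))
          \<le> (real m + 1) * (real m * (h * (cmod w)\<^sup>2 + Im w) + (h * (cmod v)\<^sup>2 + real m * Im v))"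
        using mult_left_mono[OF cv, of h] h by (simp add: algebra_simps)
      also have "\<dots> \<le> 0"
      proof -
        have "real m * (h * (cmod w)\<^sup>2 + Im w) \<le> 0"
          using w m by (intro mult_nonneg_nonpos) auto
        with IH show ?thesis by (intro mult_nonneg_nonpos) auto
      qed
      finally show ?thesis
        using m by (simp add: mult_le_0_iff)
    qed
    then show ?thesis
      unfolding sum h_def by (simp add: add.commute)
  qed
qed

text \<open>
  For $P=\sum_k{m+1\choose k}\beta_kx^k$ the sum in the conclusion is
  $P(x)+(y-x)P'(x)/(m+1)$, up to a factor the polar derivative of $P$ with pole $y$. If it vanished,
  $1/(x-y)$ would be the mean of $m+1$ points of the disc of \<open>log_deriv_in_disc\<close> and would
  itself lie there, which means $\Im y\le-\epsilon$.
\<close>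

lemma laguerre_polar:
  fixes \<beta> :: "nat \<Rightarrow> complex"
  assumes nz: "\<And>u. Im u > - \<epsilon> \<Longrightarrow> (\<Sum>k\<le>Suc m. of_nat (Suc m choose k) * \<beta> k * u ^ k) \<noteq> 0"
    and x: "Im x > - \<epsilon>" and y: "Im y > - \<epsilon>"
  shows "(\<Sum>k\<le>m. of_nat (m choose k) * (\<beta> k + y * \<beta> (Suc k)) * x ^ k) \<noteq> 0"
proof
  assume zero: "(\<Sum>k\<le>m. of_nat (m choose k) * (\<beta> k + y * \<beta> (Suc k)) * x ^ k) = 0"
  define P where "P = (\<Sum>k\<le>Suc m. monom (of_nat (Suc m choose k) * \<beta> k) k)"
  define B where "B = (\<Sum>k\<le>m. of_nat (m choose k) * \<beta> (Suc k) * x ^ k)"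
  have poly_P: "poly P u = (\<Sum>k\<le>Suc m. of_nat (Suc m choose k) * \<beta> k * u ^ k)" for u
    unfolding P_def by (simp only: poly_sum poly_monom)
  have deg: "degree P \<le> Suc m"
    unfolding P_def
    by (intro degree_sum_le) (auto intro: order.trans[OF degree_monom_le])
  have P': "poly (pderiv P) x = of_nat (Suc m) * B"
  proof -
    have "poly (pderiv P) x =
        (\<Sum>k\<le>Suc m. of_nat k * (of_nat (Suc m choose k) * \<beta> k) * x ^ (k - 1))"
      unfolding P_def by (simp only: higher_pderiv_sum[of 1, simplified] pderiv_monom poly_sum poly_monom)
    also have "\<dots> = (\<Sum>k\<le>m. of_nat (Suc k * (Suc m choose Suc k)) * \<beta> (Suc k) * x ^ k)"
      by (subst sum.atMost_Suc_shift) (simp add: algebra_simps del: binomial_Suc_Suc)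
    also have "\<dots> = of_nat (Suc m) * B"
      unfolding Suc_times_binomial B_def by (simp only: of_nat_mult sum_distrib_left mult.assoc)
    finally show ?thesis .
  qed
  have P: "poly P x = (\<Sum>k\<le>m. of_nat (m choose k) * \<beta> k * x ^ k) + x * B"
    unfolding poly_P B_def
    using sum_binomial_Suc[of m "\<lambda>k. \<beta> k * x ^ k"]
    by (simp add: sum.distrib sum_distrib_left algebra_simps)
  have "(\<Sum>k\<le>m. of_nat (m choose k) * \<beta> k * x ^ k) + y * B = 0"
    using zero unfolding B_def by (simp add: sum.distrib sum_distrib_left algebra_simps)
  with P have eq: "poly P x = (x - y) * B"
    by (simp add: left_diff_distrib add_eq_0_iff)
  have Px: "poly P x \<noteq> 0" using nz[OF x] poly_P by simp
  define u where "u = 1 / (x - y)"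
  have "poly (pderiv P) x / poly P x = of_nat (Suc m) * u"
    using Px unfolding P' eq u_def by (simp add: field_simps)
  moreover have "(Im x + \<epsilon>) * (cmod (poly (pderiv P) x / poly P x))\<^sup>2
           + real (Suc m) * Im (poly (pderiv P) x / poly P x) \<le> 0"
    using deg nz x unfolding poly_P[symmetric] by (rule log_deriv_in_disc)
  ultimately have "(Im x + \<epsilon>) * (cmod (of_nat (Suc m) * u))\<^sup>2
       + real (Suc m) * Im (of_nat (Suc m) * u) \<le> 0" by simp
  then have "(real (Suc m))\<^sup>2 * ((Im x + \<epsilon>) * (cmod u)\<^sup>2 + Im u) \<le> 0"
    by (simp add: norm_mult power2_eq_square algebra_simps del: of_nat_Suc)
  then have "(Im x + \<epsilon>) * (cmod u)\<^sup>2 + Im u \<le> 0"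
    by (simp add: mult_le_0_iff del: of_nat_Suc)
  moreover have "Im u = - Im (x - y) * (cmod u)\<^sup>2"
    unfolding u_def by (simp add: Im_divide norm_divide cmod_power2 power_divide)
  ultimately have "(Im y + \<epsilon>) * (cmod u)\<^sup>2 \<le> 0"
    by (simp add: algebra_simps)
  moreover have "cmod u > 0"
    using Px eq by (auto simp: u_def)
  ultimately show False
    using y by (simp add: mult_le_0_iff)
qed

section \<open>The diagonal functional\<close>

lemma Im_minus_inverse_nonneg: "Im z \<ge> 0 \<Longrightarrow> Im (- 1 / z) \<ge> 0"
  by (simp add: Im_divide)

text \<open>
  If $a=e$, the polynomial is $a(1+xs)+bx+cs$, which on the curve $s=-1/x$ reduces to $bx-c/x$.
  If $b$ and $c$ are nonzero, one of the two roots of $x^2=c/b$ has nonnegative imaginary part, and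
  then so has $-1/x$. The half-planes extend below the real line because that root may be real, and
  because $a\neq0$ comes from the point $(0,0)$.
\<close>

lemma biaffine_functional_nonzero:
  fixes a b c e :: complex
  assumes "\<epsilon> > 0" and "\<eta> > 0"
    and nz: "\<And>x s. Im x > - \<epsilon> \<Longrightarrow> Im s > - \<eta> \<Longrightarrow> a + b * x + c * s + e * x * s \<noteq> 0"
  shows "a - e \<noteq> 0"
proof
  assume "a - e = 0"
  have nz': "a * (1 + x * s) + b * x + c * s \<noteq> 0" if "Im x \<ge> 0" "Im s \<ge> 0" for x s
    using nz[of x s] that assms(1,2) \<open>a - e = 0\<close> by (simp add: algebra_simps)
  have a: "a \<noteq> 0" using nz'[of 0 0] by simp
  consider "b = 0" | "c = 0" | "b \<noteq> 0" "c \<noteq> 0" by blast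
  then show False
  proof cases
    case 1
    \<comment> \<open>The zero is $s=-1/(x+c/a)$; any $x$ high enough in the upper half-plane will do.\<close>
    define x where "x = \<i> * of_real (1 + cmod (c / a))"
    have *: "Im (x + c / a) > 0"
      using abs_Im_le_cmod[of "c / a"] unfolding x_def by simp
    then have "x + c / a \<noteq> 0" by (metis less_irrefl zero_complex.sel(2))
    then have "a * (1 + x * (- 1 / (x + c / a))) + c * (- 1 / (x + c / a)) = 0"
      using a by (simp add: field_simps)
    moreover have "Im (- 1 / (x + c / a)) \<ge> 0"
      using * by (intro Im_minus_inverse_nonneg) simp
    moreover have "Im x \<ge> 0"
      unfolding x_def by simp
    ultimately show False using nz'[of x "- 1 / (x + c / a)"] 1 by simp
  next
    case 2
    define x where "x = \<i> * of_real (1 + cmod (b / a))"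
    have *: "Im (x + b / a) > 0"
      using abs_Im_le_cmod[of "b / a"] unfolding x_def by simp
    then have "x + b / a \<noteq> 0" by (metis less_irrefl zero_complex.sel(2))
    then have "a * (1 + (- 1 / (x + b / a)) * x) + b * (- 1 / (x + b / a)) = 0"
      using a by (simp add: field_simps)
    moreover have "Im (- 1 / (x + b / a)) \<ge> 0"
      using * by (intro Im_minus_inverse_nonneg) simp
    moreover have "Im x \<ge> 0"
      unfolding x_def by simp
    ultimately show False using nz'[of "- 1 / (x + b / a)" x] 2 by simp
  next
    case 3
    obtain x where x: "x\<^sup>2 = c / b" and im: "Im x \<ge> 0"
    proof (cases "Im (csqrt (c / b)) \<ge> 0")
      case True
      then show ?thesis using that[of "csqrt (c / b)"] by simp
    next
      case False
      then show ?thesis using that[of "- csqrt (c / b)"] by simp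
    qed
    have "x \<noteq> 0" using x 3 by auto
    have "Im (- 1 / x) \<ge> 0"
      using im by (rule Im_minus_inverse_nonneg)
    moreover have "a * (1 + x * (- 1 / x)) + b * x + c * (- 1 / x) = 0"
      using x \<open>x \<noteq> 0\<close> 3 by (simp add: field_simps power2_eq_square)
    ultimately show False using nz' im by blast
  qed
qed

text \<open>
  The induction step replaces $\alpha_{kj}$ by $\alpha_{kj}-\alpha_{k+1,j+1}$. With binomial
  coefficients split off, the polar derivative becomes the shift
  $\beta_k\mapsto\beta_k+y\beta_{k+1}$, which is why they appear in the statement.
\<close>

lemma diagonal_functional_nonzero:
  fixes \<alpha> :: "nat \<Rightarrow> nat \<Rightarrow> complex"
  assumes "\<epsilon> > 0" and "\<eta> > 0"
    and nz: "\<And>x s. Im x > - \<epsilon> \<Longrightarrow> Im s > - \<eta> \<Longrightarrow>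
      (\<Sum>k\<le>d. \<Sum>j\<le>d. of_nat (d choose k) * of_nat (d choose j) * \<alpha> k j * x ^ k * s ^ j) \<noteq> 0"
  shows "(\<Sum>k\<le>d. of_nat (d choose k) * ((- 1) ^ k * \<alpha> k k)) \<noteq> 0"
  using nz
proof (induction d arbitrary: \<alpha>)
  case 0
  from 0[of 0 0] show ?case using assms by simp
next
  case (Suc m)
  let ?F = "\<lambda>\<alpha> x s. \<Sum>k\<le>m. \<Sum>j\<le>m.
    of_nat (m choose k) * of_nat (m choose j) * \<alpha> k j * x ^ k * s ^ j :: complex"
  \<comment> \<open>One application of Laguerre's theorem in each variable, with poles $x_1$ and $s_1$.\<close>
  have step: "?F \<alpha> x s + ?F (\<lambda>k. \<alpha> (Suc k)) x s * x1 + ?F (\<lambda>k j. \<alpha> k (Suc j)) x s * s1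
       + ?F (\<lambda>k j. \<alpha> (Suc k) (Suc j)) x s * x1 * s1 \<noteq> 0"
    if x: "Im x > - \<epsilon>" "Im x1 > - \<epsilon>" and s: "Im s > - \<eta>" "Im s1 > - \<eta>" for x x1 s s1
  proof -
    have 1: "(\<Sum>k\<le>m. of_nat (m choose k) *
        ((\<Sum>j\<le>Suc m. of_nat (Suc m choose j) * \<alpha> k j * s ^ j)
          + x1 * (\<Sum>j\<le>Suc m. of_nat (Suc m choose j) * \<alpha> (Suc k) j * s ^ j)) * x ^ k) \<noteq> 0"
      if "Im s > - \<eta>" for s
    proof (rule laguerre_polar[OF _ x])
      fix u assume "Im u > - \<epsilon>"
      from Suc.prems[OF this that]
      show "(\<Sum>k\<le>Suc m. of_nat (Suc m choose k) *
        (\<Sum>j\<le>Suc m. of_nat (Suc m choose j) * \<alpha> k j * s ^ j) * u ^ k) \<noteq> 0"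
        by (simp only: sum_distrib_left sum_distrib_right mult_ac not_False_eq_True)
    qed
    have "(\<Sum>j\<le>m. of_nat (m choose j) *
        ((\<Sum>k\<le>m. of_nat (m choose k) * (\<alpha> k j + x1 * \<alpha> (Suc k) j) * x ^ k)
          + s1 * (\<Sum>k\<le>m. of_nat (m choose k) * (\<alpha> k (Suc j) + x1 * \<alpha> (Suc k) (Suc j)) * x ^ k))
        * s ^ j) \<noteq> 0"
    proof (rule laguerre_polar[OF _ s])
      fix u assume "Im u > - \<eta>"
      from 1[OF this]
      show "(\<Sum>j\<le>Suc m. of_nat (Suc m choose j) *
        (\<Sum>k\<le>m. of_nat (m choose k) * (\<alpha> k j + x1 * \<alpha> (Suc k) j) * x ^ k) * u ^ j) \<noteq> 0"
        unfolding sum_distrib_left sum_distrib_right sum.distrib[symmetric]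
        by (subst sum.swap) (simp only: algebra_simps not_False_eq_True)
    qed
    also have "(\<Sum>j\<le>m. of_nat (m choose j) *
        ((\<Sum>k\<le>m. of_nat (m choose k) * (\<alpha> k j + x1 * \<alpha> (Suc k) j) * x ^ k)
          + s1 * (\<Sum>k\<le>m. of_nat (m choose k) * (\<alpha> k (Suc j) + x1 * \<alpha> (Suc k) (Suc j)) * x ^ k))
        * s ^ j) = ?F \<alpha> x s + ?F (\<lambda>k. \<alpha> (Suc k)) x s * x1 + ?F (\<lambda>k j. \<alpha> k (Suc j)) x s * s1
       + ?F (\<lambda>k j. \<alpha> (Suc k) (Suc j)) x s * x1 * s1"
      unfolding sum_distrib_left sum_distrib_right sum.distrib[symmetric]
      by (subst sum.swap) (simp only: algebra_simps)
    finally show ?thesis .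
  qed
  have "?F (\<lambda>k j. \<alpha> k j - \<alpha> (Suc k) (Suc j)) x s \<noteq> 0" if "Im x > - \<epsilon>" "Im s > - \<eta>" for x s
  proof -
    have "?F \<alpha> x s - ?F (\<lambda>k j. \<alpha> (Suc k) (Suc j)) x s \<noteq> 0"
      using step that by (intro biaffine_functional_nonzero[OF assms(1,2)]) blast
    then show ?thesis
      by (simp add: algebra_simps sum_subtractf)
  qed
  \<comment> \<open>Pascal's rule and the alternating sign identify the two functionals.\<close>
  from Suc.IH[OF this] show ?case
    by (simp add: sum_binomial_Suc right_diff_distrib del: sum.atMost_Suc binomial_Suc_Suc)
qed

text \<open>
  The inner sum is the coefficient $a_{kk}$ after $x$ has been replaced by $x+i\epsilon$. The
  translation moves the real $x$-axis into the interior of the zero-free half-plane.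
\<close>

lemma shifted_diagonal_functional_nonzero:
  fixes c :: "nat \<Rightarrow> nat \<Rightarrow> complex"
  assumes "\<epsilon> > 0" and "\<eta> > 0"
    and nz: "\<And>x s. Im x > 0 \<Longrightarrow> Im s > - \<eta> \<Longrightarrow> (\<Sum>l\<le>d. x ^ l * (\<Sum>j\<le>d. c l j * s ^ j)) \<noteq> 0"
  shows "(\<Sum>k\<le>d. (- 1) ^ k / of_nat (d choose k) *
           (\<Sum>l\<le>d. of_nat (l choose k) * (\<i> * of_real \<epsilon>) ^ (l - k) * c l k)) \<noteq> 0"
proof -
  define e where "e = \<i> * complex_of_real \<epsilon>"
  define a where "a k j = (\<Sum>l\<le>d. of_nat (l choose k) * e ^ (l - k) * c l j)" for k j
  define \<alpha> where "\<alpha> k j = a k j / (of_nat (d choose k) * of_nat (d choose j))" for k j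
  have ne: "complex_of_nat (d choose k) \<noteq> 0" if "k \<le> d" for k
    using that by simp
  have pow: "(x + e) ^ l = (\<Sum>k\<le>d. of_nat (l choose k) * x ^ k * e ^ (l - k))" if "l \<le> d" for x l
    unfolding binomial_ring using that by (intro sum.mono_neutral_left) auto
  have "(\<Sum>k\<le>d. of_nat (d choose k) * ((- 1) ^ k * \<alpha> k k)) \<noteq> 0"
  proof (rule diagonal_functional_nonzero[where \<alpha> = \<alpha>, OF assms(1,2)])
    fix x s assume xs: "Im x > - \<epsilon>" "Im s > - \<eta>"
    have "(\<Sum>k\<le>d. \<Sum>j\<le>d. of_nat (d choose k) * of_nat (d choose j) * \<alpha> k j * x ^ k * s ^ j)
        = (\<Sum>k\<le>d. \<Sum>j\<le>d. \<Sum>l\<le>d. of_nat (l choose k) * x ^ k * e ^ (l - k) * (c l j * s ^ j))"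
    proof (intro sum.cong refl)
      fix k j assume "k \<in> {..d}" "j \<in> {..d}"
      then have "of_nat (d choose k) * of_nat (d choose j) * \<alpha> k j = a k j"
        using ne by (simp add: \<alpha>_def)
      then show "of_nat (d choose k) * of_nat (d choose j) * \<alpha> k j * x ^ k * s ^ j =
          (\<Sum>l\<le>d. of_nat (l choose k) * x ^ k * e ^ (l - k) * (c l j * s ^ j))"
        by (simp add: a_def sum_distrib_left sum_distrib_right mult_ac)
    qed
    also have "\<dots> = (\<Sum>k\<le>d. \<Sum>l\<le>d. \<Sum>j\<le>d. of_nat (l choose k) * x ^ k * e ^ (l - k) * (c l j * s ^ j))"
      by (intro sum.cong refl sum.swap)
    also have "\<dots> = (\<Sum>l\<le>d. \<Sum>k\<le>d. \<Sum>j\<le>d. of_nat (l choose k) * x ^ k * e ^ (l - k) * (c l j * s ^ j))"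
      by (rule sum.swap)
    also have "\<dots> = (\<Sum>l\<le>d. (x + e) ^ l * (\<Sum>j\<le>d. c l j * s ^ j))"
      by (intro sum.cong refl) (simp add: pow sum_product)
    finally show "(\<Sum>k\<le>d. \<Sum>j\<le>d. of_nat (d choose k) * of_nat (d choose j) * \<alpha> k j * x ^ k * s ^ j) \<noteq> 0"
      using nz[of "x + e" s] xs by (simp add: e_def)
  qed
  also have "(\<Sum>k\<le>d. of_nat (d choose k) * ((- 1) ^ k * \<alpha> k k))
      = (\<Sum>k\<le>d. (- 1) ^ k / of_nat (d choose k) * a k k)"
    using ne by (intro sum.cong refl) (simp add: \<alpha>_def)
  finally show ?thesis
    unfolding a_def e_def .
qed

section \<open>Evaluation of multivariate polynomials\<close>

lemma eval_mvpoly_mult: "eval_mvpoly (p * q) z = eval_mvpoly p z * eval_mvpoly q z"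
proof -
  have mono: "(\<Prod>i\<in>keys (m + m'). z i ^ lookup (m + m') i) =
      (\<Prod>i\<in>keys m. z i ^ lookup m i) * (\<Prod>i\<in>keys m'. z i ^ lookup m' i)" for m m'
  proof -
    let ?U = "keys m \<union> keys m'"
    have *: "(\<Prod>i\<in>keys m''. z i ^ lookup m'' i) = (\<Prod>i\<in>?U. z i ^ lookup m'' i)"
      if "keys m'' \<subseteq> ?U" for m''
      using that by (intro prod.mono_neutral_left) (auto simp: in_keys_iff)
    show ?thesis
      unfolding *[OF Poly_Mapping.keys_add] *[OF Un_upper1] *[OF Un_upper2]
      by (simp add: lookup_add power_add prod.distrib)
  qed
  have "p * q = (\<Sum>m\<in>keys p. \<Sum>m'\<in>keys q. single (m + m') (lookup p m * lookup q m'))"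
    by (subst poly_mapping_eq_sum[of p], subst poly_mapping_eq_sum[of q])
      (simp only: sum_product mult_single)
  then show ?thesis
    by (simp add: eval_mvpoly_sum eval_mvpoly_single mono)
      (simp add: eval_mvpoly_def sum_product mult_ac)
qed

lemma eval_mvpoly_Const [simp]: "eval_mvpoly (Const c) z = c"
  by (simp add: Const_def eval_mvpoly_single)

lemma eval_mvpoly_Var_power: "eval_mvpoly (Var i ^ k) z = z i ^ k"
  unfolding Var_power eval_mvpoly_single by (cases "k = 0") simp_all

lemma eval_mvpoly_cong:
  assumes "\<And>i. i \<in> vars p \<Longrightarrow> z i = w i"
  shows "eval_mvpoly p z = eval_mvpoly p w"
proof -
  have "z i = w i" if "m \<in> keys p" "i \<in> keys m" for m i
    using assms that by (auto simp: vars_def)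
  then show ?thesis
    unfolding eval_mvpoly_def by simp
qed

lemma eval_mvpoly_coeff_in:
  assumes "\<And>m. m \<in> keys p \<Longrightarrow> lookup m i \<le> d"
  shows "eval_mvpoly p z = (\<Sum>k\<le>d. z i ^ k * eval_mvpoly (coeff_in i k p) z)"
proof -
  have "eval_mvpoly p z = eval_mvpoly (\<Sum>k=0..d. Var i ^ k * coeff_in i k p) z"
    using coeff_in_decomposition[of p i d] assms by simp
  then show ?thesis
    by (simp add: eval_mvpoly_sum eval_mvpoly_mult eval_mvpoly_Var_power atMost_atLeast0)
qed

lemma lookup_pd_funpow_nonzero:
  "lookup ((pd i ^^ j) p) m \<noteq> 0 \<Longrightarrow> lookup p (m + single i j) \<noteq> 0"
proof (induction j arbitrary: m)
  case (Suc j)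
  then have "lookup ((pd i ^^ j) p) (m + single i 1) \<noteq> 0"
    by (auto simp: lookup_pd)
  from Suc.IH[OF this] show ?case
    by (simp add: add.assoc single_add[symmetric])
qed simp

text \<open>
  The iterated formal derivatives evaluate to the iterated complex derivatives, so this is the
  power series expansion of an entire function, cut off where the formal derivatives vanish.
\<close>

lemma eval_mvpoly_taylor:
  fixes p :: "complex mvpoly"
  assumes deg: "\<And>m. m \<in> keys p \<Longrightarrow> lookup m i \<le> d"
  shows "eval_mvpoly p (z(i := z i + s)) =
    (\<Sum>j\<le>d. eval_mvpoly ((pd i ^^ j) p) z / fact j * s ^ j)"
proof -
  let ?f = "\<lambda>t. eval_mvpoly p (z(i := t))"
  have D: "((\<lambda>t. eval_mvpoly q (z(i := t))) has_field_derivative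
      eval_mvpoly (pd i q) (z(i := t))) (at t)" for q t
    using eval_pd[of q "z(i := t)" i] by simp
  have deriv: "(deriv ^^ j) ?f = (\<lambda>t. eval_mvpoly ((pd i ^^ j) p) (z(i := t)))" for j
  proof (induction j)
    case (Suc j)
    show ?case
      unfolding funpow.simps o_apply Suc.IH by (rule ext) (rule DERIV_imp_deriv[OF D])
  qed simp
  have "?f holomorphic_on ball (z i) (norm s + 1)"
    using D by (auto simp: holomorphic_on_def field_differentiable_def
        intro: has_field_derivative_at_within)
  moreover have "z i + s \<in> ball (z i) (norm s + 1)"
    by (simp add: dist_norm)
  ultimately have "(\<lambda>j. (deriv ^^ j) ?f (z i) / fact j * (z i + s - z i) ^ j) sums ?f (z i + s)"
    by (rule holomorphic_power_series)
  then have sums: "(\<lambda>j. eval_mvpoly ((pd i ^^ j) p) z / fact j * s ^ j) sums ?f (z i + s)"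
    by (simp add: deriv)
  have "(pd i ^^ j) p = 0" if "j > d" for j
  proof (rule poly_mapping_eqI, rule ccontr)
    fix m assume "lookup ((pd i ^^ j) p) m \<noteq> lookup 0 m"
    then have "m + single i j \<in> keys p"
      using lookup_pd_funpow_nonzero[where i = i and j = j and p = p and m = m] by (simp add: in_keys_iff)
    from deg[OF this] that show False by (simp add: lookup_add)
  qed
  then have "(\<lambda>j. eval_mvpoly ((pd i ^^ j) p) z / fact j * s ^ j) sums
      (\<Sum>j\<le>d. eval_mvpoly ((pd i ^^ j) p) z / fact j * s ^ j)"
    by (intro sums_finite) (auto simp: eval_mvpoly_def)
  with sums show ?thesis
    by (simp add: sums_unique2)
qed

text \<open>
  Only one variable at a time has to be chosen: a nonzero coefficient with respect to it is
  nonzero somewhere by induction, and then a univariate polynomial has finitely many roots.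
\<close>

lemma exists_eval_mvpoly_nonzero:
  fixes p :: "complex mvpoly"
  assumes "infinite S" and "p \<noteq> 0"
  obtains w where "\<And>i. w i \<in> S" and "eval_mvpoly p w \<noteq> 0"
proof -
  have "\<exists>w. (\<forall>i. w i \<in> S) \<and> eval_mvpoly p w \<noteq> 0"
    using assms(2)
  proof (induction "card (vars p)" arbitrary: p rule: less_induct)
    case (less p)
    have fin: "finite (vars p)" by (simp add: vars_def)
    show ?case
    proof (cases "vars p = {}")
      case True
      then have "keys p \<subseteq> {0}" by (auto simp: vars_def)
      moreover have "keys p \<noteq> {}" using less.prems by simp
      ultimately have "keys p = {0}" by blast
      moreover obtain c where "c \<in> S" using assms(1) by fastforce
      ultimately show ?thesis
        by (intro exI[of _ "\<lambda>_. c"]) (simp add: eval_mvpoly_def in_keys_iff[symmetric])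
    next
      case False
      then obtain i where i: "i \<in> vars p" by blast
      define d where "d = Max ((\<lambda>m. lookup m i) ` keys p)"
      have d: "lookup m i \<le> d" if "m \<in> keys p" for m
        using that by (auto simp: d_def)
      obtain k where k: "k \<le> d" "coeff_in i k p \<noteq> 0"
      proof (rule ccontr)
        assume "\<not> thesis"
        with that have "coeff_in i k p = 0" if "k \<le> d" for k using \<open>k \<le> d\<close> by blast
        then have "p = 0"
          using coeff_in_decomposition[of p i d, OF d] by simp
        with less.prems show False ..
      qed
      have sub: "vars (coeff_in i k p) \<subseteq> vars p - {i}"
      proof
        fix j assume j: "j \<in> vars (coeff_in i k p)"
        then obtain m where "lookup p (m + single i k) \<noteq> 0" and "lookup m j \<noteq> 0"
          by (auto simp: vars_def in_keys_iff lookup_coeff_in split: if_splits)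
        then have "m + single i k \<in> keys p" and "j \<in> keys (m + single i k)"
          by (simp_all add: in_keys_iff lookup_add)
        then show "j \<in> vars p - {i}"
          using j vars_coeff_in[of i k p] unfolding vars_def by blast
      qed
      have "card (vars (coeff_in i k p)) < card (vars p)"
        using sub i fin by (intro psubset_card_mono) auto
      from less.hyps[OF this k(2)] obtain w
        where w: "\<And>i. w i \<in> S" "eval_mvpoly (coeff_in i k p) w \<noteq> 0" by blast
      define P where "P = (\<Sum>k\<le>d. monom (eval_mvpoly (coeff_in i k p) w) k)"
      have "coeff P k \<noteq> 0"
        using k(1) w(2) by (simp add: P_def coeff_sum)
      then have "P \<noteq> 0" by auto
      then have "finite {t. poly P t = 0}" by (rule poly_roots_finite)
      then obtain t where t: "t \<in> S" "poly P t \<noteq> 0"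
        using assms(1) by (metis (mono_tags) finite_subset mem_Collect_eq subsetI)
      have "eval_mvpoly p (w(i := t)) = poly P t"
      proof -
        have "eval_mvpoly (coeff_in i k p) (w(i := t)) = eval_mvpoly (coeff_in i k p) w" for k
          using vars_coeff_in[of i k p] by (intro eval_mvpoly_cong) auto
        then show ?thesis
          by (subst eval_mvpoly_coeff_in[OF d])
            (simp_all add: P_def poly_sum poly_monom mult.commute)
      qed
      then show ?thesis
        using w(1) t by (intro exI[of _ "w(i := t)"]) auto
    qed
  qed
  then show ?thesis using that by blast
qed

section \<open>The operator $R_d$\<close>

text \<open>The coefficient of $x^ls^j$ in $p(x,z_2+s,z_3,\ldots)$.\<close>

definition taylor_coeff :: "complex mvpoly \<Rightarrow> nat \<Rightarrow> nat \<Rightarrow> (nat \<Rightarrow> complex) \<Rightarrow> complex" where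
  "taylor_coeff p l j z = eval_mvpoly ((pd 2 ^^ j) (coeff_in 1 l p)) z / fact j"

text \<open>
  The value at \<open>z\<close> of $R_d$ applied to $p(z_1+e,z_2,\ldots)$, for \<open>p\<close> of degree at most
  \<open>d\<close> in $z_1$, written as a polynomial in \<open>e\<close> so that the limit at \<open>e = 0\<close> is visible.
\<close>

definition R_perturbed :: "nat \<Rightarrow> complex mvpoly \<Rightarrow> complex \<Rightarrow> (nat \<Rightarrow> complex) \<Rightarrow> complex" where
  "R_perturbed d p e z = (\<Sum>k\<le>d. (- 1) ^ k / of_nat (d choose k) *
           (\<Sum>l\<le>d. of_nat (l choose k) * e ^ (l - k) * taylor_coeff p l k z))"

text \<open>
  At \<open>e = 0\<close> only $l=k$ survives: for $l<k$ the truncated exponent gives $0^0=1$, but then the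
  binomial coefficient is $0$.
\<close>

lemma R_perturbed_0: "R_perturbed d p 0 z = eval_mvpoly (R_op d p) z"
proof -
  have "(\<Sum>l\<le>d. of_nat (l choose k) * 0 ^ (l - k) * taylor_coeff p l k z) = taylor_coeff p k k z"
    if "k \<le> d" for k
  proof -
    have "(\<Sum>l\<le>d. of_nat (l choose k) * 0 ^ (l - k) * taylor_coeff p l k z) =
        (\<Sum>l\<le>d. if l = k then taylor_coeff p l k z else 0)"
      by (intro sum.cong refl) (auto simp: power_0_left)
    then show ?thesis using that by simp
  qed
  then have "R_perturbed d p 0 z =
      (\<Sum>k\<le>d. (- 1) ^ k / of_nat (d choose k) * taylor_coeff p k k z)"
    unfolding R_perturbed_def by simp
  also have "\<dots> = (\<Sum>k\<le>d. 1 / fact d * ((- 1) ^ k * fact (d - k) *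
      eval_mvpoly ((pd 2 ^^ k) (coeff_in 1 k p)) z))"
  proof (intro sum.cong refl)
    fix k assume "k \<in> {..d}"
    then have "complex_of_nat (d choose k) = fact d / (fact k * fact (d - k))"
      by (simp add: binomial_fact)
    then show "(- 1) ^ k / of_nat (d choose k) * taylor_coeff p k k z = 1 / fact d *
      ((- 1) ^ k * fact (d - k) * eval_mvpoly ((pd 2 ^^ k) (coeff_in 1 k p)) z)"
      by (simp add: taylor_coeff_def)
  qed
  also have "\<dots> = eval_mvpoly (R_op d p) z"
    by (simp add: R_op_def eval_mvpoly_mult eval_mvpoly_sum sum_distrib_left atMost_atLeast0)
  finally show ?thesis .
qed

lemma R_perturbed_nonzero:
  assumes deg: "\<And>m. m \<in> keys p \<Longrightarrow> lookup m 1 \<le> d \<and> lookup m 2 \<le> d"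
    and st: "stable n p" and "n \<ge> 2" and z: "\<And>i. i \<in> {1..n} \<Longrightarrow> Im (z i) > 0" and "\<epsilon> > 0"
  shows "R_perturbed d p (\<i> * of_real \<epsilon>) z \<noteq> 0"
  unfolding R_perturbed_def
proof (rule shifted_diagonal_functional_nonzero[OF \<open>\<epsilon> > 0\<close>])
  show "Im (z 2) > 0" using z \<open>n \<ge> 2\<close> by simp
  fix x s assume xs: "Im x > 0" "Im s > - Im (z 2)"
  let ?w = "z(1 := x, 2 := z 2 + s)"
  have deg': "lookup m 2 \<le> d" if "m \<in> keys (coeff_in 1 l p)" for m l
  proof -
    have "m + single 1 l \<in> keys p"
      using that by (auto simp: in_keys_iff lookup_coeff_in split: if_splits)
    from deg[OF this] show ?thesis by (simp add: lookup_add)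
  qed
  have "eval_mvpoly p ?w = (\<Sum>l\<le>d. x ^ l * eval_mvpoly (coeff_in 1 l p) ?w)"
    using eval_mvpoly_coeff_in[of p 1 d ?w] deg by simp
  also have "\<dots> = (\<Sum>l\<le>d. x ^ l * eval_mvpoly (coeff_in 1 l p) (z(2 := z 2 + s)))"
  proof (intro sum.cong refl arg_cong2[where f = "(*)"] eval_mvpoly_cong)
    fix l i assume "i \<in> vars (coeff_in 1 l p)"
    then have "i \<noteq> 1" using vars_coeff_in[of 1 l p] by blast
    then show "?w i = (z(2 := z 2 + s)) i" by simp
  qed
  also have "\<dots> = (\<Sum>l\<le>d. x ^ l * (\<Sum>j\<le>d. taylor_coeff p l j z * s ^ j))"
    unfolding taylor_coeff_def using eval_mvpoly_taylor[OF deg'] by simp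
  finally show "(\<Sum>l\<le>d. x ^ l * (\<Sum>j\<le>d. taylor_coeff p l j z * s ^ j)) \<noteq> 0"
    using st z xs unfolding stable_def
    by (metis (no_types, lifting) add_less_cancel_left add.right_inverse fun_upd_apply plus_complex.sel(2))
qed

lemma holomorphic_eval_mvpoly_line:
  "(\<lambda>t. eval_mvpoly q (\<lambda>i. z i + t * v i)) holomorphic_on S"
  unfolding eval_mvpoly_def by (intro holomorphic_intros)

lemma uniform_limit_sum:
  fixes f :: "'i \<Rightarrow> 'a \<Rightarrow> 'b \<Rightarrow> 'c::real_normed_vector"
  assumes "\<And>i. i \<in> I \<Longrightarrow> uniform_limit S (f i) (l i) F"
  shows "uniform_limit S (\<lambda>n x. \<Sum>i\<in>I. f i n x) (\<lambda>x. \<Sum>i\<in>I. l i x) F"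
  using assms
  by (induction I rule: infinite_finite_induct)
    (auto intro: uniform_limit_const uniform_limit_add)

lemma R_perturbed_uniform_limit:
  assumes "compact K" and e: "e \<longlonglongrightarrow> 0"
  shows "uniform_limit K (\<lambda>n t. R_perturbed d p (e n) (\<lambda>i. z i + t * v i))
    (\<lambda>t. R_perturbed d p 0 (\<lambda>i. z i + t * v i)) sequentially"
proof -
  have "uniform_limit K
      (\<lambda>n t. ((- 1) ^ k / of_nat (d choose k) * (of_nat (l choose k) * e n ^ (l - k)))
         * taylor_coeff p l k (\<lambda>i. z i + t * v i))
      (\<lambda>t. ((- 1) ^ k / of_nat (d choose k) * (of_nat (l choose k) * 0 ^ (l - k)))
         * taylor_coeff p l k (\<lambda>i. z i + t * v i)) sequentially" for k l
  proof (rule uniform_lim_mult)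
    have "(\<lambda>n. (- 1) ^ k / of_nat (d choose k) * (of_nat (l choose k) * e n ^ (l - k)))
        \<longlonglongrightarrow> (- 1) ^ k / of_nat (d choose k) * (of_nat (l choose k) * 0 ^ (l - k))"
      by (intro tendsto_intros e)
    then show "uniform_limit K
      (\<lambda>n t. (- 1) ^ k / of_nat (d choose k) * (of_nat (l choose k) * e n ^ (l - k)))
      (\<lambda>t. (- 1) ^ k / of_nat (d choose k) * (of_nat (l choose k) * 0 ^ (l - k))) sequentially"
      unfolding uniform_limit_iff tendsto_iff by (auto elim: eventually_mono)
    show "bounded ((\<lambda>t. taylor_coeff p l k (\<lambda>i. z i + t * v i)) ` K)"
      unfolding taylor_coeff_def
      by (intro compact_imp_bounded compact_continuous_image assms(1) continuous_intros
          holomorphic_on_imp_continuous_on holomorphic_eval_mvpoly_line) simp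
  qed (auto intro: uniform_limit_const simp: image_constant_conv)
  then show ?thesis
    unfolding R_perturbed_def sum_distrib_left
    by (intro uniform_limit_sum) (simp add: mult.assoc)
qed

text \<open>
  The values of the perturbed operators have no zeros in the product of half-planes, but their
  limit could acquire one. Hurwitz's theorem excludes this on connected sets on which the limit is
  not constant. The convex set \<open>S\<close> below is such a set: the line through \<open>z\<close> and \<open>w\<close>
  intersected with the product of half-planes, where \<open>w\<close> is a point at which $R_d[p]$ does not
  vanish.
\<close>

lemma stable_R_op:
  assumes deg: "\<And>m. m \<in> keys p \<Longrightarrow> lookup m 1 \<le> d \<and> lookup m 2 \<le> d"
    and st: "stable n p" and n: "n \<ge> 2"
  shows "stable n (R_op d p) \<or> R_op d p = 0"
proof (rule disjCI)
  assume "R_op d p \<noteq> 0"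
  moreover have "infinite {u. Im u > 0}"
  proof
    assume fin: "finite {u. Im u > 0}"
    have "range (\<lambda>k::nat. Complex (of_nat k) 1) \<subseteq> {u. Im u > 0}" by auto
    with fin have "finite (range (\<lambda>k::nat. Complex (of_nat k) 1))" by (rule rev_finite_subset)
    moreover have "inj (\<lambda>k::nat. Complex (of_nat k) 1)" by (auto simp: inj_def)
    ultimately show False using finite_imageD infinite_UNIV_nat by blast
  qed
  ultimately obtain w where w: "\<And>i. Im (w i) > 0" and nz: "eval_mvpoly (R_op d p) w \<noteq> 0"
    using exists_eval_mvpoly_nonzero by (metis mem_Collect_eq)
  show "stable n (R_op d p)"
    unfolding stable_def
  proof (intro allI impI)
    fix z :: "nat \<Rightarrow> complex" assume z: "\<forall>i\<in>{1..n}. Im (z i) > 0"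
    define L where "L t = (\<lambda>i. z i + t * (w i - z i))" for t
    define S where "S = {t. \<forall>i\<in>{1..n}. Im (L t i) > 0}"
    show "eval_mvpoly (R_op d p) z \<noteq> 0"
    proof
      assume z0: "eval_mvpoly (R_op d p) z = 0"
      have "open S"
      proof -
        have "S = (\<Inter>i\<in>{1..n}. {t. Im (L t i) > 0})" by (auto simp: S_def)
        also have "open \<dots>"
          unfolding L_def by (intro open_INT ballI open_Collect_less continuous_intros) auto
        finally show ?thesis .
      qed
      moreover have "convex S"
        unfolding convex_def
      proof (intro ballI allI impI)
        fix t t' and a b :: real
        assume t: "t \<in> S" "t' \<in> S" and ab: "0 \<le> a" "0 \<le> b" "a + b = 1"
        have eq: "L (a *\<^sub>R t + b *\<^sub>R t') i = a *\<^sub>R L t i + b *\<^sub>R L t' i" for i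
        proof -
          have "a *\<^sub>R L t i + b *\<^sub>R L t' i
              = (a + b) *\<^sub>R z i + (a *\<^sub>R t + b *\<^sub>R t') * (w i - z i)"
            unfolding L_def by (simp add: scaleR_add_left algebra_simps)
          then show ?thesis using ab(3) by (simp add: L_def)
        qed
        show "a *\<^sub>R t + b *\<^sub>R t' \<in> S"
          unfolding S_def mem_Collect_eq eq
        proof
          fix i assume "i \<in> {1..n}"
          then have "Im (L t i) > 0" "Im (L t' i) > 0" using t by (auto simp: S_def)
          moreover have "a > 0 \<or> b > 0" using ab by linarith
          ultimately show "Im (a *\<^sub>R L t i + b *\<^sub>R L t' i) > 0"
            using ab by (auto intro: add_pos_nonneg add_nonneg_pos)
        qed
      qed
      moreover have "0 \<in> S" "1 \<in> S" using z w by (auto simp: S_def L_def)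
      moreover define F where
        "F k t = R_perturbed d p (\<i> * of_real (inverse (Suc k))) (L t)" for k t
      moreover have "F k holomorphic_on S" for k
        unfolding F_def R_perturbed_def taylor_coeff_def L_def
        by (intro holomorphic_intros holomorphic_eval_mvpoly_line) auto
      moreover have "uniform_limit K F (\<lambda>t. R_perturbed d p 0 (L t)) sequentially"
        if "compact K" for K
      proof -
        have "(\<lambda>k. \<i> * complex_of_real (inverse (Suc k))) \<longlonglongrightarrow> \<i> * of_real 0"
          by (intro tendsto_intros LIMSEQ_inverse_real_of_nat)
        then show ?thesis
          unfolding F_def L_def using R_perturbed_uniform_limit[OF that] by simp
      qed
      moreover have "F k t \<noteq> 0" if "t \<in> S" for k t
        unfolding F_def
        by (rule R_perturbed_nonzero[OF deg st n]) (use that in \<open>auto simp: S_def\<close>)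
      moreover have "(\<lambda>t. R_perturbed d p 0 (L t)) holomorphic_on S"
        unfolding R_perturbed_0 L_def by (rule holomorphic_eval_mvpoly_line)
      moreover have "\<not> (\<lambda>t. R_perturbed d p 0 (L t)) constant_on S"
      proof
        assume "(\<lambda>t. R_perturbed d p 0 (L t)) constant_on S"
        then have "R_perturbed d p 0 (L 0) = R_perturbed d p 0 (L 1)"
          using \<open>0 \<in> S\<close> \<open>1 \<in> S\<close> unfolding constant_on_def by metis
        with z0 nz show False by (simp add: R_perturbed_0 L_def)
      qed
      ultimately have "R_perturbed d p 0 (L 0) \<noteq> 0"
        by (intro Hurwitz_no_zeros[of S F "\<lambda>t. R_perturbed d p 0 (L t)" 0] convex_connected) auto
      with z0 show False by (simp add: R_perturbed_0 L_def)
    qed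
  qed
qed

section \<open>Reduction of $S_d$ to $R_d$\<close>

text \<open>The polynomial $(-z_1)^d\,p(-1/z_1,z_2,\ldots)$, for \<open>p\<close> of degree at most \<open>d\<close> in
  $z_1$.\<close>

definition reversed :: "nat \<Rightarrow> complex mvpoly \<Rightarrow> complex mvpoly" where
  "reversed d p = (\<Sum>k=0..d. Var 1 ^ k * (Const ((- 1) ^ k) * coeff_in 1 (d - k) p))"

text \<open>
  The coefficient of $z_1^k$ in the reversed polynomial is $(-1)^kQ_{d-k}$, whose sign cancels the
  one in the definition of $R_d$.
\<close>

lemma R_op_reversed: "R_op d (reversed d p) = S_op d p"
proof -
  have "1 \<notin> vars (Const ((- 1) ^ k) * coeff_in 1 (d - k) p)" for k
    using vars_coeff_in[of 1 "d - k" p] by (auto simp: vars_def in_keys_iff)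
  then have "R_op d (reversed d p) = Const (1 / fact d) * (\<Sum>k=0..d. Const ((- 1) ^ k * fact (d - k)) *
      (pd 2 ^^ k) (Const ((- 1) ^ k) * coeff_in 1 (d - k) p))"
    unfolding reversed_def by (intro R_op_sum) blast
  also have "(\<Sum>k=0..d. Const ((- 1) ^ k * fact (d - k)) *
      (pd 2 ^^ k) (Const ((- 1) ^ k) * coeff_in 1 (d - k) p)) =
      (\<Sum>k=0..d. Const (fact (d - k)) * (pd 2 ^^ k) (coeff_in 1 (d - k) p))"
  proof (intro sum.cong refl)
    fix k
    have "(- 1) ^ k * ((- 1) ^ k * x) = (x :: complex)" for x
      by (simp flip: mult.assoc power_add mult_2 add: power_mult)
    then show "Const ((- 1) ^ k * fact (d - k)) *
      (pd 2 ^^ k) (Const ((- 1) ^ k) * coeff_in 1 (d - k) p) =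
      Const (fact (d - k)) * (pd 2 ^^ k) (coeff_in 1 (d - k) p)"
      by (intro poly_mapping_eqI) (simp add: pd_funpow_Const_mult mult_ac)
  qed
  also have "\<dots> = (\<Sum>k=0..d. Const (fact k) * (pd 2 ^^ (d - k)) (coeff_in 1 k p))"
    by (rule sum.reindex_bij_witness[of _ "\<lambda>k. d - k" "\<lambda>k. d - k"]) auto
  finally show ?thesis unfolding S_op_def .
qed

lemma stable_reversed:
  assumes deg: "\<And>m. m \<in> keys p \<Longrightarrow> lookup m 1 \<le> d" and st: "stable n p" and "n \<ge> 1"
  shows "stable n (reversed d p)"
  unfolding stable_def
proof (intro allI impI)
  fix z :: "nat \<Rightarrow> complex" assume z: "\<forall>i\<in>{1..n}. Im (z i) > 0"
  let ?w = "z(1 := - 1 / z 1)"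
  define q where "q k = eval_mvpoly (coeff_in 1 k p) z" for k
  have z1: "Im (z 1) > 0" using z \<open>n \<ge> 1\<close> by simp
  then have z1_0: "z 1 \<noteq> 0" by auto
  have "Im (- 1 / z 1) > 0"
    using z1 by (simp add: Im_divide add_nonneg_pos)
  then have "Im (?w i) > 0" if "i \<in> {1..n}" for i
    using z that by simp
  then have "eval_mvpoly p ?w \<noteq> 0"
    using st by (simp add: stable_def)
  moreover have "eval_mvpoly (coeff_in 1 k p) ?w = q k" for k
    unfolding q_def using vars_coeff_in[of 1 k p] by (intro eval_mvpoly_cong) auto
  ultimately have nz: "(\<Sum>k\<le>d. (- 1 / z 1) ^ k * q k) \<noteq> 0"
    using eval_mvpoly_coeff_in[of p 1 d ?w] deg by simp
  have "eval_mvpoly (reversed d p) z = (\<Sum>k\<le>d. z 1 ^ k * ((- 1) ^ k * q (d - k)))"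
    by (simp add: reversed_def eval_mvpoly_sum eval_mvpoly_mult eval_mvpoly_Var_power q_def
        atMost_atLeast0)
  also have "\<dots> = (\<Sum>k\<le>d. (- z 1) ^ k * q (d - k))"
    by (simp only: power_minus[of "z 1"] mult_ac)
  also have "\<dots> = (\<Sum>k\<le>d. (- z 1) ^ (d - k) * q k)"
    by (rule sum.reindex_bij_witness[of _ "\<lambda>k. d - k" "\<lambda>k. d - k"]) auto
  also have "\<dots> = (- z 1) ^ d * (\<Sum>k\<le>d. (- 1 / z 1) ^ k * q k)"
    unfolding sum_distrib_left
  proof (intro sum.cong refl)
    fix k assume "k \<in> {..d}"
    then have "(- z 1) ^ d = (- z 1) ^ (d - k) * (- z 1) ^ k"
      by (simp flip: power_add)
    moreover have "(- z 1) ^ k * (- 1 / z 1) ^ k = 1"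
      using z1_0 by (simp flip: power_mult_distrib)
    ultimately show "(- z 1) ^ (d - k) * q k = (- z 1) ^ d * ((- 1 / z 1) ^ k * q k)"
      by (simp add: mult.assoc flip: mult.assoc[of _ "(- 1 / z 1) ^ k"])
  qed
  finally show "eval_mvpoly (reversed d p) z \<noteq> 0"
    using nz z1_0 by simp
qed

lemma degree_reversed_le:
  assumes deg: "\<And>m. m \<in> keys p \<Longrightarrow> lookup m i \<le> d" and m: "m \<in> keys (reversed d p)"
  shows "lookup m i \<le> d"
proof -
  have "lookup (reversed d p) m \<noteq> 0" using m by (simp add: in_keys_iff)
  then obtain k where k: "k \<le> d"
      "m \<in> keys (Var 1 ^ k * (Const ((- 1) ^ k) * coeff_in 1 (d - k) p))"
    unfolding reversed_def lookup_sum
    by (auto simp: in_keys_iff elim!: sum.not_neutral_contains_not_neutral)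
  then obtain a b where m: "m = a + b" and a: "a \<in> keys (Var 1 ^ k :: complex mvpoly)"
      and b: "b \<in> keys (Const ((- 1) ^ k) * coeff_in 1 (d - k) p)"
    using keys_mult[of "Var 1 ^ k" "Const ((- 1) ^ k) * coeff_in 1 (d - k) p"] by blast
  have a: "a = single 1 k"
    using a by (simp add: Var_power)
  have "b + single 1 (d - k) \<in> keys p" and b1: "lookup b 1 = 0"
    using b by (auto simp: in_keys_iff lookup_coeff_in split: if_splits)
  then have "lookup (b + single 1 (d - k)) i \<le> d" by (intro deg)
  then show ?thesis
    using k(1) b1 by (cases "i = 1") (auto simp: m a lookup_add lookup_single)
qed

theorem corollary6p2:
  fixes n d :: nat and \<kappa> :: "nat \<Rightarrow> nat"
  assumes "n \<ge> 2" and "\<kappa> 1 = d" and "\<kappa> 2 = d"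
  shows "preserves_stability n (bounded_polys n \<kappa>) (S_op d) \<and>
         preserves_stability n (bounded_polys n \<kappa>) (R_op d)"
proof -
  have deg: "lookup m 1 \<le> d \<and> lookup m 2 \<le> d" if "p \<in> bounded_polys n \<kappa>" "m \<in> keys p" for p m
  proof -
    have "\<forall>i\<in>{1..n}. lookup m i \<le> \<kappa> i"
      using that by (simp add: bounded_polys_def)
    from bspec[OF this, of 1] bspec[OF this, of 2] show ?thesis
      using assms by simp
  qed
  have "stable n (R_op d p) \<or> R_op d p = 0" if "p \<in> bounded_polys n \<kappa>" "stable n p" for p
    using deg[OF that(1)] that(2) assms(1) by (rule stable_R_op)
  moreover have "stable n (S_op d p) \<or> S_op d p = 0"
    if p: "p \<in> bounded_polys n \<kappa>" and st: "stable n p" for p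
    unfolding R_op_reversed[symmetric]
  proof (rule stable_R_op[OF _ _ assms(1)])
    show "lookup m 1 \<le> d \<and> lookup m 2 \<le> d" if "m \<in> keys (reversed d p)" for m
      using degree_reversed_le[OF _ that] deg[OF p] by blast
    show "stable n (reversed d p)"
      using deg[OF p] st assms(1) by (intro stable_reversed) auto
  qed
  ultimately show ?thesis unfolding preserves_stability_def by blast
qed

end
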